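(* Let $X,Y$ be real vector spaces, let $A\colon X\to Y$ be a linear mapping, and let $\varphi\colon Y\to(-\infty,\infty]$ be a convex function. Assume that the range of $A$ contains a point of $\mathrm{core}(\mathrm{dom}(\varphi))$ and that $\mathrm{core}(\mathrm{epi}(\varphi))\neq\emptyset$. Let $\bar{x}\in X$ be such that $\bar{y}:=A(\bar{x})\in\mathrm{dom}(\varphi)$. Then $$\partial(\varphi\circ A)(\bar{x})=A^*\big(\partial\varphi(\bar{y})\big):=\{A^*g\mid g\in\partial\varphi(\bar{y})\},$$ where $A^*\colon Y'\to X'$ is the adjoint of $A$ defined by $A^*g(x):=g(Ax)$ for all $g\in Y'$ and $x\in X$.
   Context: All vector spaces are real and carry no topology. $X'$ denotes the algebraic dual of $X$ (all linear functions $X\to\mathbb{R}$). For a subset $\Omega$ of a vector space $Z$, $\mathrm{core}(\Omega):=\{x\in\Omega\mid \forall v\in Z\ \exists\delta>0\ \forall t\in\mathbb{R}\text{ with }|t|<\delta:\ x+tv\in\Omega\}$. For $\varphi\colon Y\to(-\infty,\infty]$: $\mathrm{dom}(\varphi):=\{y\in Y\mid\varphi(y)<\infty\}$ and $\mathrm{epi}(\varphi):=\{(y,\alpha)\in Y\times\mathbb{R}\mid\alpha\ge\varphi(y)\}$ (its core is taken in $Y\times\mathbb{R}$). For a convex function $\varphi$ and $\bar{y}\in\mathrm{dom}(\varphi)$, the subdifferential is $\partial\varphi(\bar{y}):=\{g\in Y'\mid\varphi(y)\ge\varphi(\bar{y})+g(y-\bar{y})\ \forall y\in Y\}$, and similarly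 for functions on $X$. *)

theory Defs
  imports "HOL-Analysis.Product_Vector" "HOL-Library.Extended_Real"
begin

text \<open>
  Real vector spaces are types of class \<^class>\<open>real_vector\<close>, which carries no topology.
  Functions with values in \<open>(-\<infinity>, \<infinity>]\<close> are functions into \<^typ>\<open>ereal\<close> that satisfy \<open>minus_infinity_free\<close>.
\<close>

definition algebraic_core :: "'z::real_vector set \<Rightarrow> 'z set" where
  "algebraic_core \<Omega> = {x \<in> \<Omega>. \<forall>v. \<exists>\<delta>>0. \<forall>t::real. \<bar>t\<bar> < \<delta> \<longrightarrow> x + t *\<^sub>R v \<in> \<Omega>}"

definition algebraic_dual :: "('z::real_vector \<Rightarrow> real) set" where
  "algebraic_dual = {g. linear g}"

text \<open>Only the value \<open>-\<infinity>\<close> is excluded; the function may be \<open>\<infinity>\<close> everywhere.\<close>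

definition minus_infinity_free :: "('y \<Rightarrow> ereal) \<Rightarrow> bool" where
  "minus_infinity_free \<phi> \<longleftrightarrow> (\<forall>y. \<phi> y \<noteq> -\<infinity>)"

definition convex_ereal :: "('y::real_vector \<Rightarrow> ereal) \<Rightarrow> bool" where
  "convex_ereal \<phi> \<longleftrightarrow> (\<forall>x y. \<forall>t::real. 0 < t \<and> t < 1 \<longrightarrow>
     \<phi> ((1 - t) *\<^sub>R x + t *\<^sub>R y) \<le> ereal (1 - t) * \<phi> x + ereal t * \<phi> y)"

definition effective_domain :: "('y \<Rightarrow> ereal) \<Rightarrow> 'y set" where
  "effective_domain \<phi> = {y. \<phi> y < \<infinity>}"

definition epigraph_ereal :: "('y \<Rightarrow> ereal) \<Rightarrow> ('y \<times> real) set" where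
  "epigraph_ereal \<phi> = {(y, \<alpha>). ereal \<alpha> \<ge> \<phi> y}"

text \<open>Meaningful only for \<open>ybar \<in> effective_domain \<phi>\<close>.\<close>

definition subdifferential :: "('y::real_vector \<Rightarrow> ereal) \<Rightarrow> 'y \<Rightarrow> ('y \<Rightarrow> real) set" where
  "subdifferential \<phi> ybar =
     {g \<in> algebraic_dual. \<forall>y. \<phi> y \<ge> \<phi> ybar + ereal (g (y - ybar))}"

text \<open>For linear \<open>A\<close> this maps \<^const>\<open>algebraic_dual\<close> into \<^const>\<open>algebraic_dual\<close>.\<close>

definition algebraic_adjoint ::
    "('x::real_vector \<Rightarrow> 'y::real_vector) \<Rightarrow> ('y \<Rightarrow> real) \<Rightarrow> ('x \<Rightarrow> real)" where
  "algebraic_adjoint A g = (\<lambda>x. g (A x))"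

end

theory Submission imports Defs begin

text \<open>
  Let \<open>h\<close> be a subgradient of \<open>\<phi> \<circ> A\<close> and let \<open>A x0\<close> lie in the core of the domain of \<open>\<phi>\<close>.
  The pairs \<open>(v, r)\<close> such that \<open>\<phi> (A x0 + t v + A x) \<le> c + t r + h x\<close> for some \<open>t > 0\<close> and \<open>x\<close>,
  where \<open>c = \<phi> (A xbar) + h (x0 - xbar)\<close>, form a convex cone: the epigraph, up to closure, of a
  sublinear functional, finite because \<open>A x0\<close> is in the core. A linear functional below it,
  which exists by Hahn--Banach, minorizes \<open>\<phi>\<close> as required and restricts to \<open>h\<close> along \<open>A\<close>.
  Working with cones instead of functionals makes the Zorn argument painless, since the
  union of a chain of such cones is again such a cone.
\<close>

section \<open>Sublinear cones and the Hahn-Banach theorem\<close>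

definition sublinear_cone :: "('v::real_vector \<times> real) set \<Rightarrow> bool" where
  "sublinear_cone K \<longleftrightarrow>
     (\<forall>v r w s. (v, r) \<in> K \<longrightarrow> (w, s) \<in> K \<longrightarrow> (v + w, r + s) \<in> K) \<and>
     (\<forall>a v r. 0 < a \<longrightarrow> (v, r) \<in> K \<longrightarrow> (a *\<^sub>R v, a * r) \<in> K) \<and>
     (\<forall>v. \<exists>r. (v, r) \<in> K) \<and>
     (\<forall>r. (0, r) \<in> K \<longrightarrow> 0 \<le> r)"

lemma sublinear_coneD:
  assumes "sublinear_cone K"
  shows sublinear_cone_add: "\<And>v r w s. (v, r) \<in> K \<Longrightarrow> (w, s) \<in> K \<Longrightarrow> (v + w, r + s) \<in> K"
    and sublinear_cone_scale: "\<And>a v r. 0 < a \<Longrightarrow> (v, r) \<in> K \<Longrightarrow> (a *\<^sub>R v, a * r) \<in> K"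
    and sublinear_cone_total: "\<And>v. \<exists>r. (v, r) \<in> K"
    and sublinear_cone_zero: "\<And>r. (0, r) \<in> K \<Longrightarrow> 0 \<le> r"
  using assms unfolding sublinear_cone_def by blast+

text \<open>Each closure condition concerns at most two pairs, and in a chain both lie in one
  member. Nonemptiness of \<open>C\<close> supplies some \<open>r\<close> over every
  \<open>v\<close>.\<close>

lemma sublinear_cone_Union_chain:
  assumes "C \<noteq> {}" "subset.chain {K. sublinear_cone K} C"
  shows "sublinear_cone (\<Union>C)"
proof -
  have cone: "sublinear_cone K" if "K \<in> C" for K
    using assms(2) that unfolding subset.chain_def by auto
  have lin: "K \<subseteq> L \<or> L \<subseteq> K" if "K \<in> C" "L \<in> C" for K L
    using assms(2) that unfolding subset_chain_def by blast
  have "(v + w, r + s) \<in> \<Union>C" if vw: "(v, r) \<in> \<Union>C" "(w, s) \<in> \<Union>C" for v r w s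
  proof -
    obtain K L where KL: "K \<in> C" "(v, r) \<in> K" "L \<in> C" "(w, s) \<in> L"
      using vw by blast
    then obtain M where "M \<in> C" "(v, r) \<in> M" "(w, s) \<in> M"
      using lin by blast
    then show ?thesis
      using sublinear_cone_add[OF cone] by blast
  qed
  moreover have "\<exists>r. (v, r) \<in> \<Union>C" for v
    using assms(1) sublinear_cone_total[OF cone] by blast
  ultimately show ?thesis
    unfolding sublinear_cone_def
    using sublinear_cone_scale[OF cone] sublinear_cone_zero[OF cone] by (meson UnionE UnionI)
qed

lemma sublinear_cone_maximal_exists:
  assumes "sublinear_cone K"
  obtains M where "sublinear_cone M" "K \<subseteq> M" "\<And>L. sublinear_cone L \<Longrightarrow> M \<subseteq> L \<Longrightarrow> L = M"
proof -
  let ?S = "{L. sublinear_cone L \<and> K \<subseteq> L}"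
  have "\<exists>M\<in>?S. \<forall>L\<in>?S. M \<subseteq> L \<longrightarrow> L = M"
  proof (rule subset_Zorn_nonempty)
    show "?S \<noteq> {}" using assms by blast
  next
    fix C assume C: "C \<noteq> {}" "subset.chain ?S C"
    have "C \<subseteq> ?S" and tot: "\<forall>X\<in>C. \<forall>Y\<in>C. X \<subseteq> Y \<or> Y \<subseteq> X"
      using iffD1[OF subset_chain_def C(2)] by simp_all
    then have "C \<subseteq> {K. sublinear_cone K}"
      by auto
    then have "subset.chain {K. sublinear_cone K} C"
      using tot by (simp only: subset_chain_def)
    then have "sublinear_cone (\<Union>C)"
      by (rule sublinear_cone_Union_chain[OF C(1)])
    moreover have "K \<subseteq> \<Union>C"
    proof -
      obtain L where "L \<in> C" using C(1) by auto
      then show ?thesis using \<open>C \<subseteq> ?S\<close> by auto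
    qed
    ultimately show "\<Union>C \<in> ?S" by simp
  qed
  then obtain M where M: "sublinear_cone M" "K \<subseteq> M"
    and max: "\<forall>L\<in>?S. M \<subseteq> L \<longrightarrow> L = M"
    by auto
  have "L = M" if "sublinear_cone L" "M \<subseteq> L" for L
    using max M(2) that by simp
  with M show ?thesis by (rule that)
qed

text \<open>Adding a fixed pair over \<open>- v\<close> lands over 0, where second components are
  nonnegative. So the infimum of the \<open>r\<close> over each \<open>v\<close> is a real number:
  the value at \<open>v\<close> of the sublinear functional that \<open>K\<close> encodes.\<close>

lemma sublinear_cone_bdd_below:
  assumes "sublinear_cone K"
  shows "bdd_below {r. (v, r) \<in> K}"
proof -
  obtain s where s: "(- v, s) \<in> K"
    using sublinear_cone_total[OF assms] by blast
  have "- s \<le> r" if "(v, r) \<in> K" for r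
    using sublinear_cone_zero[OF assms, of "r + s"] sublinear_cone_add[OF assms that s] by simp
  then show ?thesis
    by (intro bdd_belowI[of _ "- s"]) auto
qed

text \<open>Adjoining the ray through \<open>(w, s)\<close> forces the functional to be at most
  \<open>s\<close> at \<open>w\<close>. Only nonnegativity over 0 could fail: a pair there with
  \<open>a > 0\<close> stems from \<open>(- (a *\<^sub>R w), p)\<close> in \<open>K\<close>, and
  \<open>no\<close>, applied after division by \<open>a\<close>, gives \<open>p + a * s\<close> at
  least 0. Allowing \<open>a = 0\<close> keeps \<open>K\<close> inside the extension.\<close>

lemma sublinear_cone_extend:
  assumes K: "sublinear_cone K"
    and no: "\<And>r. (- w, r) \<in> K \<Longrightarrow> - s \<le> r"
  shows "sublinear_cone {(v + a *\<^sub>R w, r + a * s) |v r a. (v, r) \<in> K \<and> 0 \<le> a}"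
    (is "sublinear_cone ?L")
proof -
  have "(v + v', r + r') \<in> ?L" if vr: "(v, r) \<in> ?L" "(v', r') \<in> ?L" for v r v' r'
  proof -
    obtain u p a u' p' a'
      where *: "v = u + a *\<^sub>R w" "r = p + a * s" "(u, p) \<in> K" "0 \<le> a"
        "v' = u' + a' *\<^sub>R w" "r' = p' + a' * s" "(u', p') \<in> K" "0 \<le> a'"
      using vr by blast
    have "v + v' = (u + u') + (a + a') *\<^sub>R w" "r + r' = (p + p') + (a + a') * s"
      using * by (auto simp: algebra_simps)
    moreover have "(u + u', p + p') \<in> K" "0 \<le> a + a'"
      using * sublinear_cone_add[OF K] by auto
    ultimately show ?thesis by blast
  qed
  moreover have "(b *\<^sub>R v, b * r) \<in> ?L" if b: "0 < b" "(v, r) \<in> ?L" for b v r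
  proof -
    obtain u p a where *: "v = u + a *\<^sub>R w" "r = p + a * s" "(u, p) \<in> K" "0 \<le> a"
      using b by blast
    have "b *\<^sub>R v = b *\<^sub>R u + (b * a) *\<^sub>R w" "b * r = b * p + (b * a) * s"
      using * by (auto simp: algebra_simps)
    moreover have "(b *\<^sub>R u, b * p) \<in> K" "0 \<le> b * a"
      using * b sublinear_cone_scale[OF K] by auto
    ultimately show ?thesis by blast
  qed
  moreover have "\<exists>r. (v, r) \<in> ?L" for v
  proof -
    obtain r where "(v, r) \<in> K" using sublinear_cone_total[OF K] by blast
    then have "(v + 0 *\<^sub>R w, r + 0 * s) \<in> ?L" by blast
    then show ?thesis by auto
  qed
  moreover have "0 \<le> r" if zr: "(0, r) \<in> ?L" for r
  proof -
    obtain u p a where *: "0 = u + a *\<^sub>R w" "r = p + a * s" "(u, p) \<in> K" "0 \<le> a"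
      using zr by blast
    show ?thesis
    proof (cases "a = 0")
      case True
      then show ?thesis using * sublinear_cone_zero[OF K] by simp
    next
      case False
      then have "0 < a" using * by simp
      have "u = - (a *\<^sub>R w)" using *(1) by (simp add: eq_neg_iff_add_eq_0)
      then have "(1 / a) *\<^sub>R u = - w" using \<open>0 < a\<close> by simp
      then have "(- w, (1 / a) * p) \<in> K"
        using sublinear_cone_scale[OF K, of "1 / a" u p] *(3) \<open>0 < a\<close> by simp
      then have "- s \<le> p / a" using no by fastforce
      then show ?thesis using * \<open>0 < a\<close> by (simp add: field_simps)
    qed
  qed
  ultimately show ?thesis
    unfolding sublinear_cone_def by blast
qed

text \<open>The functional \<open>g\<close> of a maximal cone \<open>M\<close> is sublinear. If
  \<open>- g (- w)\<close> were below some \<open>s < g w\<close>, then \<open>(w, s)\<close> could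
  be adjoined to \<open>M\<close>, contradicting maximality. Hence \<open>g\<close> is odd, and an
  odd sublinear functional is linear.\<close>

theorem sublinear_cone_linear_minorant:
  assumes "sublinear_cone K"
  shows "\<exists>g. linear g \<and> (\<forall>v r. (v, r) \<in> K \<longrightarrow> g v \<le> r)"
proof -
  obtain M where M: "sublinear_cone M" "K \<subseteq> M"
    and max: "\<And>L. sublinear_cone L \<Longrightarrow> M \<subseteq> L \<Longrightarrow> L = M"
    using sublinear_cone_maximal_exists[OF assms] by blast
  define g where "g v = Inf {r. (v, r) \<in> M}" for v
  have ne: "{r. (v, r) \<in> M} \<noteq> {}" for v
    using sublinear_cone_total[OF M(1)] by simp
  have lower: "g v \<le> r" if "(v, r) \<in> M" for v r
    unfolding g_def using that by (intro cInf_lower sublinear_cone_bdd_below M) auto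
  \<comment> \<open>The infimum need not be attained, hence the arguments with an arbitrary
    \<open>e > 0\<close> below.\<close>
  have near: "\<exists>r. (v, r) \<in> M \<and> r < g v + e" if "0 < e" for v e
    using cInf_lessD[OF ne, of v "g v + e"] that unfolding g_def by auto
  have sub: "g (v + w) \<le> g v + g w" for v w
  proof (rule field_le_epsilon)
    fix e :: real assume "0 < e"
    then obtain r s where "(v, r) \<in> M" "r < g v + e / 2" "(w, s) \<in> M" "s < g w + e / 2"
      using near[of "e / 2"] by (meson half_gt_zero)
    then show "g (v + w) \<le> g v + g w + e"
      using lower[OF sublinear_cone_add[OF M(1)]] by fastforce
  qed
  have scale_le: "g (a *\<^sub>R v) \<le> a * g v" if a: "0 < a" for a v
  proof (rule field_le_epsilon)
    fix e :: real assume "0 < e"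
    then obtain r where "(v, r) \<in> M" "r < g v + e / a"
      using near[of "e / a"] a by (meson divide_pos_pos)
    then have "g (a *\<^sub>R v) \<le> a * r" "a * r \<le> a * (g v + e / a)"
      using lower[OF sublinear_cone_scale[OF M(1) a]] a by (auto intro!: mult_left_mono)
    then show "g (a *\<^sub>R v) \<le> a * g v + e"
      using a by (simp add: distrib_left)
  qed
  have neg_le: "g (- w) \<le> - s" if s: "s < g w" for w s
  proof (rule ccontr)
    assume not: "\<not> g (- w) \<le> - s"
    let ?L = "{(v + a *\<^sub>R w, r + a * s) |v r a. (v, r) \<in> M \<and> 0 \<le> a}"
    have "- s \<le> r" if "(- w, r) \<in> M" for r
      using lower[OF that] not by linarith
    then have "sublinear_cone ?L"
      by (rule sublinear_cone_extend[OF M(1)])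
    moreover have "M \<subseteq> ?L"
    proof
      fix x assume x: "x \<in> M"
      obtain v r where "x = (v, r)" by (cases x)
      then have "x = (v + 0 *\<^sub>R w, r + 0 * s)" "(v, r) \<in> M" using x by auto
      then show "x \<in> ?L" by blast
    qed
    ultimately have L: "?L = M" by (rule max)
    \<comment> \<open>The clauses do not put \<open>(0, 0)\<close> into \<open>M\<close>, so
      \<open>(w, s)\<close> is reached only up to a small multiple \<open>d * p\<close> of a pair
      over 0. The denominator \<open>p + 1\<close> in \<open>d\<close> allows for
      \<open>p = 0\<close>.\<close>
    obtain p where p: "(0, p) \<in> M" using sublinear_cone_total[OF M(1)] by blast
    have "g w \<le> s"
    proof (rule field_le_epsilon)
      fix e :: real assume "0 < e"
      have "0 \<le> p" using sublinear_cone_zero[OF M(1) p] .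
      define d where "d = e / (p + 1)"
      have d: "0 < d" "d * p \<le> e"
        using \<open>0 < e\<close> \<open>0 \<le> p\<close> unfolding d_def by (auto simp: field_simps)
      have "(d *\<^sub>R 0, d * p) \<in> M" using sublinear_cone_scale[OF M(1) d(1) p] .
      then have "(0 + 1 *\<^sub>R w, d * p + 1 * s) \<in> ?L"
        by (simp only: scaleR_zero_right) (use zero_le_one in blast)
      then have "(w, d * p + s) \<in> M" unfolding L by simp
      then show "g w \<le> s + e" using lower d by fastforce
    qed
    then show False using s by simp
  qed
  have zero: "g 0 = 0"
  proof (rule antisym)
    show "g 0 \<le> 0" using scale_le[of "1/2" 0] by simp
    show "0 \<le> g 0" unfolding g_def
      using sublinear_cone_zero[OF M(1)] by (intro cInf_greatest ne) auto
  qed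
  have neg: "g (- w) = - g w" for w
  proof (rule antisym)
    show "g (- w) \<le> - g w"
    proof (rule field_le_epsilon)
      fix e :: real assume "0 < e"
      then show "g (- w) \<le> - g w + e" using neg_le[of "g w - e" w] by simp
    qed
    show "- g w \<le> g (- w)" using sub[of w "- w"] zero by simp
  qed
  have add: "g (v + w) = g v + g w" for v w
    using sub[of v w] sub[of "- v" "- w"] neg[of "v + w"] neg[of v] neg[of w] by simp
  have pos: "g (a *\<^sub>R v) = a * g v" if "0 < a" for a v
    using scale_le[OF that, of v] scale_le[OF that, of "- v"] neg[of v] neg[of "a *\<^sub>R v"] by simp
  have "g (a *\<^sub>R v) = a * g v" for a v
  proof (cases "a \<ge> 0")
    case True
    then show ?thesis using pos[of a v] zero by (cases "a = 0") auto
  next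
    case False
    then show ?thesis using pos[of "- a" v] neg[of "a *\<^sub>R v"] by simp
  qed
  then have "linear g" using add by (intro linearI) auto
  then show ?thesis using lower M(2) by blast
qed

section \<open>Extending a linear minorant along a linear map\<close>

lemma convex_ereal_le:
  assumes "convex_ereal \<phi>" "0 < t" "t < 1" "\<phi> x \<le> ereal a" "\<phi> y \<le> ereal b"
  shows "\<phi> ((1 - t) *\<^sub>R x + t *\<^sub>R y) \<le> ereal ((1 - t) * a + t * b)"
proof -
  have "\<phi> ((1 - t) *\<^sub>R x + t *\<^sub>R y) \<le> ereal (1 - t) * \<phi> x + ereal t * \<phi> y"
    using assms unfolding convex_ereal_def by blast
  also have "\<dots> \<le> ereal (1 - t) * ereal a + ereal t * ereal b"
    using assms by (intro add_mono ereal_mult_left_mono) auto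
  finally show ?thesis by simp
qed

text \<open>Convexity gives closure under addition, the free choice of \<open>t\<close> gives
  scaling, and the core point gives a finite value of \<open>\<phi>\<close> a little way along every
  \<open>v\<close>. Over \<open>v = 0\<close> the inequality compares \<open>\<phi>\<close> at
  \<open>y0 + A x\<close> with its lower bound \<open>below\<close>, which leaves
  \<open>t * r\<close> nonnegative.\<close>

lemma sublinear_cone_directional:
  fixes A :: "'x::real_vector \<Rightarrow> 'y::real_vector"
  assumes A: "linear A" and h: "linear h" and conv: "convex_ereal \<phi>"
    and core: "y0 \<in> algebraic_core (effective_domain \<phi>)"
    and below: "\<And>x. ereal (c + h x) \<le> \<phi> (y0 + A x)"
  shows "sublinear_cone {(v, r). \<exists>t>0. \<exists>x. \<phi> (y0 + t *\<^sub>R v + A x) \<le> ereal (c + t * r + h x)}"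
    (is "sublinear_cone ?K")
proof -
  have "(v + w, r + s) \<in> ?K" if vw: "(v, r) \<in> ?K" "(w, s) \<in> ?K" for v r w s
  proof -
    obtain p x q y where *: "0 < p" "\<phi> (y0 + p *\<^sub>R v + A x) \<le> ereal (c + p * r + h x)"
      "0 < q" "\<phi> (y0 + q *\<^sub>R w + A y) \<le> ereal (c + q * s + h y)"
      using vw by blast
    \<comment> \<open>This weight gives \<open>v\<close> and \<open>w\<close> the same coefficient
      \<open>p * q / (p + q)\<close> in the convex combination.\<close>
    define t where "t = p / (p + q)"
    have t: "0 < t" "t < 1" using * unfolding t_def by auto
    have eq: "(1 - t) * p = t * q" using * unfolding t_def by (simp add: field_simps)
    let ?m = "t * q" and ?z = "(1 - t) *\<^sub>R x + t *\<^sub>R y"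
    have "\<phi> ((1 - t) *\<^sub>R (y0 + p *\<^sub>R v + A x) + t *\<^sub>R (y0 + q *\<^sub>R w + A y))
        \<le> ereal ((1 - t) * (c + p * r + h x) + t * (c + q * s + h y))"
      by (rule convex_ereal_le[OF conv t *(2,4)])
    moreover have "(1 - t) *\<^sub>R (y0 + p *\<^sub>R v + A x) + t *\<^sub>R (y0 + q *\<^sub>R w + A y)
        = y0 + ((1 - t) * p) *\<^sub>R v + ?m *\<^sub>R w + A ?z"
      by (simp add: linear_add[OF A] linear_scale[OF A] linear_diff[OF A] algebra_simps)
    moreover have "\<dots> = y0 + ?m *\<^sub>R (v + w) + A ?z"
      unfolding eq by (simp add: scaleR_add_right)
    moreover have "(1 - t) * (c + p * r + h x) + t * (c + q * s + h y)
        = c + ((1 - t) * p) * r + ?m * s + h ?z"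
      by (simp add: linear_add[OF h] linear_scale[OF h] linear_diff[OF h] algebra_simps)
    moreover have "\<dots> = c + ?m * (r + s) + h ?z"
      unfolding eq by (simp add: distrib_left)
    ultimately have "\<phi> (y0 + ?m *\<^sub>R (v + w) + A ?z) \<le> ereal (c + ?m * (r + s) + h ?z)"
      by (simp only:)
    moreover have "0 < ?m" using * t by simp
    ultimately show ?thesis by blast
  qed
  moreover have "(a *\<^sub>R v, a * r) \<in> ?K" if a: "0 < a" "(v, r) \<in> ?K" for a v r
  proof -
    obtain t x where *: "0 < t" "\<phi> (y0 + t *\<^sub>R v + A x) \<le> ereal (c + t * r + h x)"
      using a by blast
    have "0 < t / a" "\<phi> (y0 + (t / a) *\<^sub>R (a *\<^sub>R v) + A x) \<le> ereal (c + (t / a) * (a * r) + h x)"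
      using * a by auto
    then show ?thesis by blast
  qed
  moreover have "\<exists>r. (v, r) \<in> ?K" for v
  proof -
    obtain d where d: "0 < d" "\<And>t. \<bar>t\<bar> < d \<Longrightarrow> y0 + t *\<^sub>R v \<in> effective_domain \<phi>"
      using core unfolding algebraic_core_def by blast
    define t where "t = d / 2"
    have t: "0 < t" using d unfolding t_def by simp
    have "\<phi> (y0 + t *\<^sub>R v) < \<infinity>"
      using d(2)[of t] d(1) unfolding t_def effective_domain_def by simp
    then obtain a where "\<phi> (y0 + t *\<^sub>R v) \<le> ereal a"
      by (cases "\<phi> (y0 + t *\<^sub>R v)") auto
    \<comment> \<open>The second component \<open>(a - c) / t\<close> is chosen so that the bound
      becomes exactly \<open>a\<close>.\<close>
    then have "\<phi> (y0 + t *\<^sub>R v + A 0) \<le> ereal (c + t * ((a - c) / t) + h 0)"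
      using t linear_0[OF A] linear_0[OF h] by simp
    then show ?thesis using t by blast
  qed
  moreover have "0 \<le> r" if zr: "(0, r) \<in> ?K" for r
  proof -
    obtain t x where *: "0 < t" "\<phi> (y0 + A x) \<le> ereal (c + t * r + h x)"
      using zr by auto
    have "ereal (c + h x) \<le> ereal (c + t * r + h x)"
      using order_trans[OF below *(2)] .
    then show ?thesis using * by (simp add: zero_le_mult_iff)
  qed
  ultimately show ?thesis
    unfolding sublinear_cone_def by blast
qed

text \<open>A linear minorant of the directional cone works: \<open>t = 1\<close> and
  \<open>x = 0\<close> give the bound on \<open>\<phi>\<close>. Large \<open>t\<close> with
  \<open>v = A x\<close>, compensated by \<open>- (t *\<^sub>R x)\<close>, give
  \<open>g (A x) \<le> h x\<close>; replacing \<open>x\<close> by \<open>- x\<close> turns this into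
  equality.\<close>

lemma linear_minorant_lift:
  fixes A :: "'x::real_vector \<Rightarrow> 'y::real_vector"
  assumes A: "linear A" and h: "linear h" and conv: "convex_ereal \<phi>"
    and core: "y0 \<in> algebraic_core (effective_domain \<phi>)"
    and below: "\<And>x. ereal (c + h x) \<le> \<phi> (y0 + A x)"
  obtains g where "linear g" "\<And>x. g (A x) = h x" "\<And>y. ereal (c + g (y - y0)) \<le> \<phi> y"
proof -
  define K where
    "K = {(v, r). \<exists>t>0. \<exists>x. \<phi> (y0 + t *\<^sub>R v + A x) \<le> ereal (c + t * r + h x)}"
  have "sublinear_cone K"
    unfolding K_def by (rule sublinear_cone_directional[OF assms])
  then obtain g where g: "linear g" and gK: "\<And>v r. (v, r) \<in> K \<Longrightarrow> g v \<le> r"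
    using sublinear_cone_linear_minorant by blast
  have le: "g v \<le> r"
    if "0 < t" "\<phi> (y0 + t *\<^sub>R v + A x) \<le> ereal (c + t * r + h x)" for v r t x
    by (rule gK) (use that in \<open>auto simp: K_def\<close>)
  have gA: "g (A x) \<le> h x" for x
  proof (rule field_le_epsilon)
    fix e :: real assume e: "0 < e"
    have "\<phi> y0 < \<infinity>" using core unfolding algebraic_core_def effective_domain_def by simp
    then obtain a where a: "\<phi> y0 \<le> ereal a" by (cases "\<phi> y0") auto
    \<comment> \<open>The constant \<open>c\<close> may lie strictly below \<open>\<phi> y0\<close>;
      \<open>t\<close> is taken so large that \<open>t * e\<close> covers the gap
      \<open>a - c\<close>.\<close>
    define t where "t = (\<bar>a - c\<bar> + 1) / e"
    have t: "0 < t" using e unfolding t_def by simp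
    have "a \<le> c + t * e" using e unfolding t_def by simp
    then have "\<phi> y0 \<le> ereal (c + t * e)" using a by (simp add: order_trans)
    moreover have "y0 + t *\<^sub>R A x + A (- (t *\<^sub>R x)) = y0"
      by (simp add: linear_neg[OF A] linear_scale[OF A])
    moreover have "c + t * (h x + e) + h (- (t *\<^sub>R x)) = c + t * e"
      by (simp add: linear_neg[OF h] linear_scale[OF h] algebra_simps)
    ultimately show "g (A x) \<le> h x + e"
      using le[OF t, of "A x" "- (t *\<^sub>R x)" "h x + e"] by (simp only:)
  qed
  have "g (A x) = h x" for x
    using gA[of x] gA[of "- x"] by (simp add: linear_neg[OF A] linear_neg[OF g] linear_neg[OF h])
  moreover have "ereal (c + g (y - y0)) \<le> \<phi> y" for y
  \<comment> \<open>Testing against real upper bounds makes the case of an infinite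
    \<open>\<phi> y\<close> vacuous.\<close>
  proof (rule ereal_le_real)
    fix z assume "\<phi> y \<le> ereal z"
    then show "ereal (c + g (y - y0)) \<le> ereal z"
      using le[of 1 "y - y0" 0 "z - c"] linear_0[OF A] linear_0[OF h] by simp
  qed
  ultimately show ?thesis using that g by blast
qed

section \<open>The chain rule for subdifferentials\<close>

theorem theorem7p2:
  fixes A :: "'x::real_vector \<Rightarrow> 'y::real_vector"
    and \<phi> :: "'y \<Rightarrow> ereal"
    and xbar :: 'x and ybar :: 'y
  assumes "linear A"
    and "minus_infinity_free \<phi>"
    and "convex_ereal \<phi>"
    and "range A \<inter> algebraic_core (effective_domain \<phi>) \<noteq> {}"
    and "algebraic_core (epigraph_ereal \<phi>) \<noteq> {}"
    and "ybar = A xbar"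
    and "ybar \<in> effective_domain \<phi>"
  shows "subdifferential (\<phi> \<circ> A) xbar = algebraic_adjoint A ` subdifferential \<phi> ybar"
proof (rule antisym)
  show "algebraic_adjoint A ` subdifferential \<phi> ybar \<subseteq> subdifferential (\<phi> \<circ> A) xbar"
    using assms(1,6) linear_compose[OF assms(1)]
    unfolding subdifferential_def algebraic_adjoint_def algebraic_dual_def
    by (auto simp: o_def linear_diff)
  show "subdifferential (\<phi> \<circ> A) xbar \<subseteq> algebraic_adjoint A ` subdifferential \<phi> ybar"
  proof
    fix h assume "h \<in> subdifferential (\<phi> \<circ> A) xbar"
    then have h: "linear h" and sub: "\<And>x. \<phi> ybar + ereal (h (x - xbar)) \<le> \<phi> (A x)"
      using assms(6) unfolding subdifferential_def algebraic_dual_def by auto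
    obtain b where b: "\<phi> ybar = ereal b"
      using assms(2,7) unfolding minus_infinity_free_def effective_domain_def
      by (cases "\<phi> ybar") auto
    obtain x0 where x0: "A x0 \<in> algebraic_core (effective_domain \<phi>)"
      using assms(4) by blast
    \<comment> \<open>The affine minorant is recentred at \<open>x0\<close>, because
      \<open>ybar\<close> itself may lie outside the core.\<close>
    define c where "c = b + h (x0 - xbar)"
    have "ereal (c + h x) \<le> \<phi> (A x0 + A x)" for x
      using sub[of "x0 + x"] b
      by (simp add: c_def linear_add[OF assms(1)] linear_add[OF h] linear_diff[OF h] algebra_simps)
    then obtain g where g: "linear g" "\<And>x. g (A x) = h x"
      "\<And>y. ereal (c + g (y - A x0)) \<le> \<phi> y"
      using linear_minorant_lift[OF assms(1) h assms(3) x0] by blast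
    \<comment> \<open>Since \<open>g\<close> agrees with \<open>h\<close> along \<open>A\<close>,
      the lifted minorant takes the value \<open>b\<close> at \<open>ybar\<close>, so it can be
      recentred there.\<close>
    have "c + g (y - A x0) = b + g (y - ybar)" for y
      using assms(6) by (simp add: c_def g(2) linear_diff[OF g(1)] linear_diff[OF h])
    then have "g \<in> subdifferential \<phi> ybar"
      using g b unfolding subdifferential_def algebraic_dual_def
      by simp
    moreover have "h = algebraic_adjoint A g"
      using g(2) unfolding algebraic_adjoint_def by auto
    ultimately show "h \<in> algebraic_adjoint A ` subdifferential \<phi> ybar" by blast
  qed
qed

end
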